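(* Let $(L,[\cdot ,\cdot ],\alpha ,\beta )$ be a left (respectively right) BiHom-Lie algebra over a field $\Bbbk$, $\lambda \in \Bbbk $ a fixed scalar and $R:L\rightarrow L$ a Rota-Baxter operator of weight $\lambda $ for $(L,[\cdot,\cdot])$ such that $R\circ \alpha =\alpha \circ R$ and $R\circ \beta =\beta \circ R$. Define a new multiplication on $L$ by $$\{x,y\}=[R(x),y]+[x,R(y)]+\lambda [x,y],\quad \forall\, x,y\in L.$$ Then $(L,\{\cdot , \cdot \} ,\alpha ,\beta )$ is a left (respectively right) BiHom-Lie algebra.
   Context: All linear spaces and (bi)linear maps are over a base field $\Bbbk$. A left (respectively right) BiHom-Leibniz algebra is a 4-tuple $(L, [\cdot ,\cdot ], \alpha , \beta )$, where $L$ is a linear space, $[\cdot , \cdot ]:L\times L\rightarrow L$ is a bilinear map and $\alpha , \beta :L\rightarrow L$ are linear maps satisfying $\alpha \circ \beta =\beta \circ \alpha $, $\alpha ([x, y])=[\alpha (x), \alpha (y)]$, $\beta ([x, y])=[\beta (x), \beta (y)]$ and $$[\alpha \beta (x), [y, z]]=[[\beta (x), y], \beta (z)]+[\beta (y), [\alpha (x), z]],$$ respectively $$[[x, y], \alpha \beta (z)]=[[x, \beta (z)], \alpha (y)]+[\alpha (x), [y, \alpha (z)]],$$ for all $x, y, z\in L$ (here $\alpha\beta=\alpha\circ\beta$). A left (respectively right) BiHom-Lie algebra is a left (respectively right) BiHom-Leibniz algebra satisfying the BiHom-skew-symmetry condition $[\beta (x), \alpha (y)]=-[\beta (y), \alpha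 (x)]$ for all $x,y\in L$. A Rota-Baxter operator of weight $\lambda$ for $(L,[\cdot,\cdot])$ is a linear map $R:L\to L$ with $[R(x),R(y)]=R([R(x),y]+[x,R(y)]+\lambda[x,y])$ for all $x,y\in L$. *)

theory Defs
  imports "HOL.Vector_Spaces"
begin

text \<open>
  A linear space \<open>L\<close> over the base field is an arbitrary additive abelian group type
  \<open>'v\<close> with a scalar multiplication \<open>scale\<close> by an arbitrary field type \<open>'k\<close>
  satisfying the locale \<open>vector_space\<close>.  There is no restriction on the dimension of
  \<open>L\<close> or on the characteristic of the field.
\<close>

locale bihom_algebra = vector_space scale
  for scale :: "'k::field \<Rightarrow> 'v::ab_group_add \<Rightarrow> 'v" +
  fixes bracket :: "'v \<Rightarrow> 'v \<Rightarrow> 'v"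
    and \<alpha> \<beta> :: "'v \<Rightarrow> 'v"
  assumes linear_bracket_left: "\<And>y. Vector_Spaces.linear scale scale (\<lambda>x. bracket x y)"
    and linear_bracket_right: "\<And>x. Vector_Spaces.linear scale scale (\<lambda>y. bracket x y)"
    and linear_\<alpha>: "Vector_Spaces.linear scale scale \<alpha>"
    and linear_\<beta>: "Vector_Spaces.linear scale scale \<beta>"
    and \<alpha>_\<beta>_commute: "\<alpha> \<circ> \<beta> = \<beta> \<circ> \<alpha>"
    and \<alpha>_bracket: "\<And>x y. \<alpha> (bracket x y) = bracket (\<alpha> x) (\<alpha> y)"
    and \<beta>_bracket: "\<And>x y. \<beta> (bracket x y) = bracket (\<beta> x) (\<beta> y)"

locale left_bihom_leibniz = bihom_algebra +
  assumes left_leibniz: "\<And>x y z.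
    bracket ((\<alpha> \<circ> \<beta>) x) (bracket y z) =
      bracket (bracket (\<beta> x) y) (\<beta> z) + bracket (\<beta> y) (bracket (\<alpha> x) z)"

locale right_bihom_leibniz = bihom_algebra +
  assumes right_leibniz: "\<And>x y z.
    bracket (bracket x y) ((\<alpha> \<circ> \<beta>) z) =
      bracket (bracket x (\<beta> z)) (\<alpha> y) + bracket (\<alpha> x) (bracket y (\<alpha> z))"

locale left_bihom_lie = left_bihom_leibniz +
  assumes bihom_skew: "\<And>x y. bracket (\<beta> x) (\<alpha> y) = - bracket (\<beta> y) (\<alpha> x)"

locale right_bihom_lie = right_bihom_leibniz +
  assumes bihom_skew: "\<And>x y. bracket (\<beta> x) (\<alpha> y) = - bracket (\<beta> y) (\<alpha> x)"

definition rota_baxter_operator ::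
  "('k::field \<Rightarrow> 'v::ab_group_add \<Rightarrow> 'v) \<Rightarrow> ('v \<Rightarrow> 'v \<Rightarrow> 'v) \<Rightarrow> 'k \<Rightarrow> ('v \<Rightarrow> 'v) \<Rightarrow> bool"
  where "rota_baxter_operator scale bracket w R \<longleftrightarrow>
    Vector_Spaces.linear scale scale R \<and>
    (\<forall>x y. bracket (R x) (R y) =
      R (bracket (R x) y + bracket x (R y) + scale w (bracket x y)))"

end

theory Submission
  imports Defs
begin

text \<open>
  Write \<open>{x, y}\<close> for \<open>[R x, y] + [x, R y] + w [x, y]\<close>. The Rota-Baxter identity says that \<open>R\<close>
  is multiplicative from the new bracket to the old one: \<open>R {x, y} = [R x, R y]\<close>. Hence in an
  iterated product such as \<open>{x, {y, z}}\<close> no \<open>R\<close> stays outside a bracket, and the product becomes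
  the sum, over the nonempty subsets of its three factors, of the products in which \<open>R\<close> is removed
  from the factors in the subset, with weight \<open>w\<close> raised to the size of the subset minus one.
  The two other products in the Leibniz identity expand over the same seven subsets. Since \<open>R\<close>
  commutes with \<open>\<alpha>\<close> and \<open>\<beta>\<close>, the Leibniz identity for the new bracket is a weighted sum of seven
  instances of the old one, at arguments \<open>x\<close> or \<open>R x\<close>, \<open>y\<close> or \<open>R y\<close>, \<open>z\<close> or \<open>R z\<close>. Skew-symmetry follows
  summand by summand: up to sign, the first summand of \<open>{\<beta> x, \<alpha> y}\<close> is the second one of
  \<open>{\<beta> y, \<alpha> x}\<close> and vice versa. This is \<open>left_bihom_lie_rota_baxter_bracket\<close>.

  The right-handed case is the left-handed one for the opposite bracket
  (\<open>right_bihom_lie_iff_opposite\<close>): passing to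
  \<open>[x, y]' = [y, x]\<close> and exchanging \<open>\<alpha>\<close> and \<open>\<beta>\<close> turns right BiHom-Lie algebras into left ones and
  back, and is compatible with Rota-Baxter operators and with the construction of the new bracket.
\<close>

text \<open>
  Reversing products turns the left-nested summand \<open>[[x, \<beta> z], \<alpha> y]\<close> of the right Leibniz identity
  into the right-nested summand of the left one, and \<open>[\<alpha> x, [y, \<alpha> z]]\<close> into the left-nested one;
  the twists match once \<open>\<alpha>\<close> and \<open>\<beta>\<close> are exchanged as well.
\<close>

lemma right_bihom_lie_iff_opposite:
  "right_bihom_lie scale bracket \<alpha> \<beta> \<longleftrightarrow> left_bihom_lie scale (\<lambda>x y. bracket y x) \<beta> \<alpha>"
proof
  assume "right_bihom_lie scale bracket \<alpha> \<beta>"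
  then interpret right_bihom_lie scale bracket \<alpha> \<beta> .
  show "left_bihom_lie scale (\<lambda>x y. bracket y x) \<beta> \<alpha>"
  proof (intro left_bihom_lie.intro left_bihom_leibniz.intro bihom_algebra.intro
      bihom_algebra_axioms.intro left_bihom_leibniz_axioms.intro left_bihom_lie_axioms.intro)
    show "bracket (bracket z y) ((\<beta> \<circ> \<alpha>) x) =
        bracket (\<alpha> z) (bracket y (\<alpha> x)) + bracket (bracket z (\<beta> x)) (\<alpha> y)" for x y z
      using right_leibniz[of z y x] by (simp only: \<alpha>_\<beta>_commute add.commute)
    show "bracket (\<beta> y) (\<alpha> x) = - bracket (\<beta> x) (\<alpha> y)" for x y
      by (rule bihom_skew)
  qed (fact vector_space_axioms linear_bracket_right linear_bracket_left linear_\<beta> linear_\<alpha>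
      \<alpha>_\<beta>_commute[symmetric] \<beta>_bracket \<alpha>_bracket)+
next
  assume "left_bihom_lie scale (\<lambda>x y. bracket y x) \<beta> \<alpha>"
  then interpret op: left_bihom_lie scale "\<lambda>x y. bracket y x" \<beta> \<alpha> .
  show "right_bihom_lie scale bracket \<alpha> \<beta>"
  proof (intro right_bihom_lie.intro right_bihom_leibniz.intro bihom_algebra.intro
      bihom_algebra_axioms.intro right_bihom_leibniz_axioms.intro right_bihom_lie_axioms.intro)
    show "bracket (bracket x y) ((\<alpha> \<circ> \<beta>) z) =
        bracket (bracket x (\<beta> z)) (\<alpha> y) + bracket (\<alpha> x) (bracket y (\<alpha> z))" for x y z
      using op.left_leibniz[where x = z and y = y and z = x] by (simp only: op.\<alpha>_\<beta>_commute add.commute)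
    show "bracket (\<beta> x) (\<alpha> y) = - bracket (\<beta> y) (\<alpha> x)" for x y
      by (rule op.bihom_skew)
  qed (fact op.vector_space_axioms op.linear_bracket_right op.linear_bracket_left op.linear_\<beta> op.linear_\<alpha>
      op.\<alpha>_\<beta>_commute[symmetric] op.\<beta>_bracket op.\<alpha>_bracket)+
qed

definition rota_baxter_bracket ::
  "('k::field \<Rightarrow> 'v::ab_group_add \<Rightarrow> 'v) \<Rightarrow> ('v \<Rightarrow> 'v \<Rightarrow> 'v) \<Rightarrow> 'k \<Rightarrow> ('v \<Rightarrow> 'v) \<Rightarrow> 'v \<Rightarrow> 'v \<Rightarrow> 'v"
  where "rota_baxter_bracket scale bracket w R x y =
    bracket (R x) y + bracket x (R y) + scale w (bracket x y)"

text \<open>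
  Read in this direction, the Rota-Baxter identity is a rewrite rule that clears every \<open>R\<close> in front
  of a new bracket.
\<close>

lemma rota_baxter_operator_iff:
  "rota_baxter_operator scale bracket w R \<longleftrightarrow>
    Vector_Spaces.linear scale scale R \<and>
    (\<forall>x y. R (rota_baxter_bracket scale bracket w R x y) = bracket (R x) (R y))"
  unfolding rota_baxter_operator_def rota_baxter_bracket_def by metis

lemma rota_baxter_bracket_opposite:
  "rota_baxter_bracket scale (\<lambda>x y. bracket y x) w R =
    (\<lambda>x y. rota_baxter_bracket scale bracket w R y x)"
  by (simp add: fun_eq_iff rota_baxter_bracket_def add.commute)

lemma rota_baxter_operator_opposite:
  assumes "rota_baxter_operator scale bracket w R"
  shows "rota_baxter_operator scale (\<lambda>x y. bracket y x) w R"
  (* An uninstantiated bracket would unify with its own opposite, and the rewriting would not end. *)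
  using assms
  by (simp add: rota_baxter_operator_iff rota_baxter_bracket_opposite[of scale bracket])

text \<open>
  Once both nestings are expanded over the seven nonempty subsets of the factors, the old Leibniz
  identity rewrites each term of the left-hand side into a term of each summand on the right, and
  only linearity and reordering of sums remain.
\<close>

lemma left_bihom_lie_rota_baxter_bracket:
  assumes lie: "left_bihom_lie scale bracket \<alpha> \<beta>"
    and RB: "rota_baxter_operator scale bracket w R"
    and R\<alpha>: "\<And>x. R (\<alpha> x) = \<alpha> (R x)"
    and R\<beta>: "\<And>x. R (\<beta> x) = \<beta> (R x)"
  shows "left_bihom_lie scale (rota_baxter_bracket scale bracket w R) \<alpha> \<beta>"
proof -
  interpret left_bihom_lie scale bracket \<alpha> \<beta> by (fact lie)
  let ?B = "rota_baxter_bracket scale bracket w R"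
  have R_lin: "R (x + y) = R x + R y" "R (scale c x) = scale c (R x)" for x y c
    using RB by (simp_all add: rota_baxter_operator_def Vector_Spaces.linear_iff)
  have R_mult: "R (?B x y) = bracket (R x) (R y)" for x y
    using RB by (simp add: rota_baxter_operator_iff)
  have bil: "bracket (x + y) z = bracket x z + bracket y z"
      "bracket x (y + z) = bracket x y + bracket x z"
      "bracket (scale c x) y = scale c (bracket x y)"
      "bracket x (scale c y) = scale c (bracket x y)" for x y z c
    using linear_bracket_left linear_bracket_right by (simp_all add: Vector_Spaces.linear_iff)
  have twist_lin: "\<alpha> (x + y) = \<alpha> x + \<alpha> y" "\<alpha> (scale c x) = scale c (\<alpha> x)"
      "\<beta> (x + y) = \<beta> x + \<beta> y" "\<beta> (scale c x) = scale c (\<beta> x)" for x y c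
    using linear_\<alpha> linear_\<beta> by (simp_all add: Vector_Spaces.linear_iff)
  \<comment> \<open>The factor to which \<open>R\<close> is applied is itself a new bracket here, so multiplicativity moves
    \<open>R\<close> inside before anything is expanded; what is left is linear in old brackets.\<close>
  have expand_right: "?B x (?B y z) =
      bracket (R x) (?B y z) + bracket x (bracket (R y) (R z)) + scale w (bracket x (?B y z))"
    for x y z
    using rota_baxter_bracket_def[of scale bracket w R x "?B y z"] by (simp only: R_mult)
  have expand_left: "?B (?B x y) z =
      bracket (bracket (R x) (R y)) z + bracket (?B x y) (R z) + scale w (bracket (?B x y) z)"
    for x y z
    using rota_baxter_bracket_def[of scale bracket w R "?B x y" z] by (simp only: R_mult)
  show ?thesis
  proof (intro left_bihom_lie.intro left_bihom_leibniz.intro bihom_algebra.intro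
      bihom_algebra_axioms.intro left_bihom_leibniz_axioms.intro left_bihom_lie_axioms.intro)
    show "?B ((\<alpha> \<circ> \<beta>) x) (?B y z) = ?B (?B (\<beta> x) y) (\<beta> z) + ?B (\<beta> y) (?B (\<alpha> x) z)" for x y z
      unfolding expand_left expand_right
      by (simp add: rota_baxter_bracket_def bil R\<alpha> R\<beta> left_leibniz[unfolded o_apply]
          scale_right_distrib ac_simps)
    show "?B (\<beta> x) (\<alpha> y) = - ?B (\<beta> y) (\<alpha> x)" for x y
      using bihom_skew[of "R x" y] bihom_skew[of x "R y"] bihom_skew[of x y]
      by (simp add: rota_baxter_bracket_def R\<alpha> R\<beta> add.commute)
    show "\<alpha> (?B x y) = ?B (\<alpha> x) (\<alpha> y)" "\<beta> (?B x y) = ?B (\<beta> x) (\<beta> y)" for x y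
      by (simp_all add: rota_baxter_bracket_def R\<alpha> R\<beta> twist_lin \<alpha>_bracket \<beta>_bracket)
    show "Vector_Spaces.linear scale scale (\<lambda>x. ?B x y)"
        "Vector_Spaces.linear scale scale (\<lambda>x. ?B y x)" for y
      by (simp_all add: Vector_Spaces.linear_iff vector_space_axioms rota_baxter_bracket_def
          R_lin bil scale_right_distrib mult.commute ac_simps)
  qed (fact vector_space_axioms linear_\<alpha> linear_\<beta> \<alpha>_\<beta>_commute)+
qed

theorem corollary4p16:
  fixes scale :: "'k::field \<Rightarrow> 'v::ab_group_add \<Rightarrow> 'v"
    and bracket brace :: "'v \<Rightarrow> 'v \<Rightarrow> 'v"
    and \<alpha> \<beta> R :: "'v \<Rightarrow> 'v"
    and w :: 'k
  assumes "rota_baxter_operator scale bracket w R"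
    and "R \<circ> \<alpha> = \<alpha> \<circ> R"
    and "R \<circ> \<beta> = \<beta> \<circ> R"
    and "\<And>x y. brace x y = bracket (R x) y + bracket x (R y) + scale w (bracket x y)"
  shows "(left_bihom_lie scale bracket \<alpha> \<beta> \<longrightarrow> left_bihom_lie scale brace \<alpha> \<beta>) \<and>
         (right_bihom_lie scale bracket \<alpha> \<beta> \<longrightarrow> right_bihom_lie scale brace \<alpha> \<beta>)"
proof -
  have brace: "brace = rota_baxter_bracket scale bracket w R"
    using assms(4) by (simp add: fun_eq_iff rota_baxter_bracket_def)
  have R\<alpha>: "R (\<alpha> x) = \<alpha> (R x)" and R\<beta>: "R (\<beta> x) = \<beta> (R x)" for x
    using assms(2,3) by (simp_all add: fun_eq_iff)
  have "left_bihom_lie scale brace \<alpha> \<beta>" if "left_bihom_lie scale bracket \<alpha> \<beta>"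
    unfolding brace using that assms(1) R\<alpha> R\<beta> by (rule left_bihom_lie_rota_baxter_bracket)
  moreover have "right_bihom_lie scale brace \<alpha> \<beta>" if "right_bihom_lie scale bracket \<alpha> \<beta>"
    using left_bihom_lie_rota_baxter_bracket[OF that[unfolded right_bihom_lie_iff_opposite]
        rota_baxter_operator_opposite[OF assms(1)] R\<beta> R\<alpha>]
    unfolding brace right_bihom_lie_iff_opposite
      rota_baxter_bracket_opposite[of scale bracket] .
  ultimately show ?thesis by blast
qed

end
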